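(* Let $f:\mathbb{N}\to\mathbb{R}$ be a nonnegative multiplicative function with $f(1)=1$. If for every prime $p$ and all integers $a,b\ge0$ one has $f(p^{a+b})\le p^a f(p^b)$ (resp. $f(p^{a+b})\ge p^a f(p^b)$), then $f$ is sub-homogeneous (resp. super-homogeneous).
   Context: $\mathbb{N}=\{1,2,3,\dots\}$. $f$ is multiplicative if $f(mn)=f(m)f(n)$ whenever $\gcd(m,n)=1$. $f$ is sub-homogeneous if $f(mn)\le m f(n)$ for all $m,n\ge1$, and super-homogeneous if $f(mn)\ge m f(n)$ for all $m,n\ge1$. *)

theory Defs
  imports Complex_Main "HOL-Computational_Algebra.Primes"
begin

(* Arithmetic functions have domain {1, 2, 3, ...}; they are represented as functions on nat
   whose value at 0 is never constrained.  The normalisation f 1 = 1 is not part of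
   "multiplicative". *)

definition multiplicative :: "(nat \<Rightarrow> real) \<Rightarrow> bool" where
  "multiplicative f \<longleftrightarrow> (\<forall>m\<ge>1. \<forall>n\<ge>1. coprime m n \<longrightarrow> f (m * n) = f m * f n)"

definition sub_homogeneous :: "(nat \<Rightarrow> real) \<Rightarrow> bool" where
  "sub_homogeneous f \<longleftrightarrow> (\<forall>m\<ge>1. \<forall>n\<ge>1. f (m * n) \<le> real m * f n)"

definition super_homogeneous :: "(nat \<Rightarrow> real) \<Rightarrow> bool" where
  "super_homogeneous f \<longleftrightarrow> (\<forall>m\<ge>1. \<forall>n\<ge>1. f (m * n) \<ge> real m * f n)"

end

theory Submission
  imports Defs
begin

text \<open>
  The claim for \<open>m\<close> follows by multiplying in the prime factors of \<open>m\<close> one at a time. For a single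
  prime \<open>p\<close>, write \<open>n = p ^ b * k\<close> with \<open>p\<close> not dividing \<open>k\<close>; by multiplicativity the claim is the
  hypothesis at \<open>a = 1\<close> multiplied by \<open>f k\<close>, which is nonnegative. Nothing distinguishes \<open>\<le>\<close> from
  \<open>\<ge>\<close> here, so the argument is carried out for an abstract preorder \<open>R\<close>.
\<close>

text \<open>Taking \<open>b\<close> to be the full multiplicity of \<open>p\<close> in
  \<open>n\<close> makes the cofactor \<open>k\<close> coprime to every power of \<open>p\<close>.
  Hence \<open>n\<close> and \<open>p * n\<close> share the same \<open>k\<close>, and passing from
  one to the other changes only the prime-power factor.\<close>

lemma multiplicative_prime_power_times:
  assumes "multiplicative f" "prime p" "n \<ge> 1"
  obtains b k where "k \<ge> 1" "n = p ^ b * k" "f n = f (p ^ b) * f k"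
    "f (p * n) = f (p ^ (1 + b)) * f k"
proof -
  have "n \<noteq> 0" "\<not> is_unit p"
    using assms by auto
  then obtain k where k: "n = p ^ multiplicity p n * k" "\<not> p dvd k"
    using multiplicity_decompose' by metis
  define b where "b = multiplicity p n"
  have n: "n = p ^ b * k"
    using k(1) by (simp only: b_def)
  have "k \<ge> 1"
    \<comment> \<open>\<open>k = 0\<close> would be divisible by \<open>p\<close>.\<close>
    using k(2) by (cases k) auto
  have coprime: "coprime (p ^ c) k" for c
    using k(2) assms(2) by (simp add: prime_imp_coprime coprime_power_left_iff)
  have split: "f (p ^ c * k) = f (p ^ c) * f k" for c
    using assms(1,2) coprime \<open>k \<ge> 1\<close> prime_gt_0_nat[OF assms(2)]
    by (simp add: multiplicative_def Suc_le_eq)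
  show thesis
  proof (rule that[OF \<open>k \<ge> 1\<close> n])
    show "f n = f (p ^ b) * f k"
      using split n by simp
    show "f (p * n) = f (p ^ (1 + b)) * f k"
      using split[of "1 + b"] n by (simp add: mult.assoc)
  qed
qed

lemma scaling_from_primes:
  fixes R :: "real \<Rightarrow> real \<Rightarrow> bool" and f :: "nat \<Rightarrow> real"
  assumes refl: "\<And>x. R x x"
    and trans: "\<And>x y z. R x y \<Longrightarrow> R y z \<Longrightarrow> R x z"
    and mono: "\<And>c x y. c \<ge> 0 \<Longrightarrow> R x y \<Longrightarrow> R (c * x) (c * y)"
    and prime: "\<And>p n. prime p \<Longrightarrow> n \<ge> 1 \<Longrightarrow> R (f (p * n)) (real p * f n)"
    and "m \<ge> 1" "n \<ge> 1"
  shows "R (f (m * n)) (real m * f n)"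
  using \<open>m \<ge> 1\<close>
proof (induction m rule: prime_divisors_induct)
  case (factor p m)
  have "m \<ge> 1"
    using factor.prems by (cases m) auto
  have "R (f (p * (m * n))) (real p * f (m * n))"
    using prime[OF factor.hyps, of "m * n"] \<open>m \<ge> 1\<close> \<open>n \<ge> 1\<close> by simp
  moreover have "R (real p * f (m * n)) (real p * (real m * f n))"
    using mono[OF _ factor.IH[OF \<open>m \<ge> 1\<close>]] by simp
  ultimately show ?case
    using trans by (simp add: mult.assoc)
\<comment> \<open>The case \<open>m = 0\<close> contradicts \<open>m \<ge> 1\<close>; the unit case
  is \<open>m = 1\<close>, where both sides equal \<open>f n\<close>.\<close>
qed (auto simp: refl)

lemma multiplicative_scaling_from_prime_powers:
  fixes R :: "real \<Rightarrow> real \<Rightarrow> bool" and f :: "nat \<Rightarrow> real"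
  assumes "\<And>x. R x x"
    and "\<And>x y z. R x y \<Longrightarrow> R y z \<Longrightarrow> R x z"
    and mono: "\<And>c x y. c \<ge> 0 \<Longrightarrow> R x y \<Longrightarrow> R (c * x) (c * y)"
    and nonneg: "\<forall>n\<ge>1. f n \<ge> 0"
    and mult: "multiplicative f"
    and power: "\<And>p a b :: nat. prime p \<Longrightarrow> R (f (p ^ (a + b))) (real p ^ a * f (p ^ b))"
    and "m \<ge> 1" "n \<ge> 1"
  shows "R (f (m * n)) (real m * f n)"
proof (rule scaling_from_primes)
  fix p n :: nat
  assume p: "prime p" and "n \<ge> 1"
  then obtain b k where "k \<ge> 1" "f n = f (p ^ b) * f k" "f (p * n) = f (p ^ (1 + b)) * f k"
    using multiplicative_prime_power_times[OF mult] by metis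
  \<comment> \<open>The scaling constant is \<open>f k\<close>. Its sign is known because
    \<open>k \<ge> 1\<close>; nothing is assumed about \<open>f 0\<close>.\<close>
  moreover have "R (f k * f (p ^ (1 + b))) (f k * (real p ^ 1 * f (p ^ b)))"
    by (rule mono[OF _ power[OF p]]) (use nonneg \<open>k \<ge> 1\<close> in auto)
  ultimately show "R (f (p * n)) (real p * f n)"
    by (simp add: mult_ac)
qed (fact assms)+

theorem theorem8:
  fixes f :: "nat \<Rightarrow> real"
  assumes nonneg: "\<forall>n\<ge>1. f n \<ge> 0"
    and mult: "multiplicative f"
    and one: "f 1 = 1"
  shows "((\<forall>p a b :: nat. prime p \<longrightarrow> f (p ^ (a + b)) \<le> real p ^ a * f (p ^ b))
            \<longrightarrow> sub_homogeneous f)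
       \<and> ((\<forall>p a b :: nat. prime p \<longrightarrow> f (p ^ (a + b)) \<ge> real p ^ a * f (p ^ b))
            \<longrightarrow> super_homogeneous f)"
proof (intro conjI impI)
  assume "\<forall>p a b :: nat. prime p \<longrightarrow> f (p ^ (a + b)) \<le> real p ^ a * f (p ^ b)"
  then show "sub_homogeneous f"
    unfolding sub_homogeneous_def
    by (intro allI impI multiplicative_scaling_from_prime_powers[where R = "(\<le>)"])
      (auto intro: mult_left_mono simp: nonneg mult)
next
  assume "\<forall>p a b :: nat. prime p \<longrightarrow> f (p ^ (a + b)) \<ge> real p ^ a * f (p ^ b)"
  then show "super_homogeneous f"
    unfolding super_homogeneous_def
    \<comment> \<open>Reversing the order keeps it a preorder preserved by scaling with
      \<open>c \<ge> 0\<close>.\<close>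
    by (intro allI impI multiplicative_scaling_from_prime_powers[where R = "(\<ge>)"])
      (auto intro: mult_left_mono simp: nonneg mult)
qed

end
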